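(* Let $J\ge 3$, let $\tilde{\tau}$ be the transposition of the last two categories (the permutation of $\{1,\dots,J\}$ exchanging $J-1$ and $J$), and let $A_{\tilde{\tau}}=\mathrm{diag}(1,\dots,1,-1)$ be the diagonal matrix of dimension $J-1$ whose diagonal entries are all $1$ except the last, which is $-1$. Then, for every symmetric cdf $F\in\tilde{\mathfrak{F}}$ and every design matrix $Z\in\mathfrak{Z}$, the following two models are equal: $$(\text{sequential},F,Z)_{\tilde{\tau}}=(\text{sequential},F,A_{\tilde{\tau}}Z).$$
   Context: Setting. Let $J\ge 3$ (number of categories), $p\ge 1$, and let $\mathcal{X}\subseteq\mathbb{R}^p$ be the nonempty set of values of the explanatory vector $x$. Let $\mathcal{M}=\{\pi\in\,]0,1[^{J-1} : \sum_{j=1}^{J-1}\pi_j<1\}$; for $\pi\in\mathcal{M}$ put $\pi_J=1-\sum_{j=1}^{J-1}\pi_j$ ($\pi_j$ is the probability of category $j$). Ratio. The sequential ratio $r:\mathcal{M}\to\,]0,1[^{J-1}$ is $r_j(\pi)=\pi_j/(\pi_j+\dots+\pi_J)$, $j=1,\dots,J-1$; it is a bijection onto $]0,1[^{J-1}$. Cdfs. $\tilde{\mathfrak{F}}$ is the set of continuous cumulative distribution functions $F$ on $\mathbb{R}$ that are strictly increasing on the open interval $I_F=\{w: 0<F(w)<1\}$ (so that $F$ maps $I_F$ bijectively onto $]0,1[$) and symmetric, i.e. $F(w)=1-F(-w)$ for all $w$. Design matrices. The complete design matrix $Z_c(x)$ is the $(J-1)\times(J-1)(1+p)$ matrix with $Z_c(x)\beta=(\alpha_j+x^t\delta_j)_{j=1,\dots,J-1}$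 for $\beta=(\alpha_1,\dots,\alpha_{J-1},\delta_1^t,\dots,\delta_{J-1}^t)^t$, $\alpha_j\in\mathbb{R}$, $\delta_j\in\mathbb{R}^p$. The set $\mathfrak{Z}$ of design matrices consists of all matrix functions $Z:x\mapsto Z_c(x)C$, where $C$ is a constant real matrix of full column rank with $q$ columns, $J-1+p\le q\le (J-1)(1+p)$. For a constant matrix $M$ of dimension $J-1$, $MZ$ denotes $x\mapsto MZ(x)$. Models. A model $(r,F,Z)$, with $Z$ having $q$ columns, has as parameter space the set of $\beta\in\mathbb{R}^q$ such that for all $x\in\mathcal{X}$, $\eta=Z(x)\beta$ satisfies $\eta\in I_F^{J-1}$ and $(F(\eta_1),\dots,F(\eta_{J-1}))\in r(\mathcal{M})$. For such $\beta$ and $x\in\mathcal{X}$, it defines the unique $\pi=\pi(x;\beta)\in\mathcal{M}$ with $r(\pi)=(F(\eta_1),\dots,F(\eta_{J-1}))^t$, $\eta=Z(x)\beta$. Permuted models. For a permutation $\sigma$ of $\{1,\dots,J\}$ and $\pi\in\mathcal{M}$, let $\pi_\sigma=(\pi_{\sigma(1)},\dots,\pi_{\sigma(J-1)})\in\mathcal{M}$. The permuted model $(r,F,Z)_\sigma$ has the same parameter space as $(r,F,Z)$ and defines $\pi=\pi(x;\beta)\in\mathcal{M}$ by $r(\pi_\sigma)=(F(\eta_1),\dots,F(\eta_{J-1}))^t$, $\eta=Z(x)\beta$ (here the ratio is evaluated at $\pi_\sigma$ with last component $1-\sum_{j=1}^{J-1}\pi_{\sigma(j)}=\pi_{\sigma(J)}$).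 Two (possibly permuted) models are equal if they have the same parameter space and give the same $\pi(x;\beta)$ for all $x\in\mathcal{X}$ and all $\beta$ in it. *)

theory Defs
  imports
    "HOL-Probability.Distribution_Functions"
    "HOL-Combinatorics.Transposition"
    "Jordan_Normal_Form.DL_Rank"
begin

unbundle no vec_syntax and no inner_syntax
hide_const (open) Finite_Cartesian_Product.vec Finite_Cartesian_Product.mat

text \<open>Categories are numbered \<open>1, \<dots>, J\<close>. Vectors and matrices carry their dimensions and are
  indexed from \<open>0\<close>, so that \<open>\<pi> $ (j - 1)\<close> is \<open>\<pi>\<^sub>j\<close> for \<open>1 \<le> j \<le> J - 1\<close>.\<close>

definition prob_vecs :: "nat \<Rightarrow> real vec set" where
  "prob_vecs J = {\<pi> \<in> carrier_vec (J - 1). (\<forall>i < J - 1. 0 < \<pi> $ i \<and> \<pi> $ i < 1) \<and> (\<Sum>i < J - 1. \<pi> $ i) < 1}"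

text \<open>\<open>cat_prob \<pi> j\<close> is \<open>\<pi>\<^sub>j\<close> for \<open>1 \<le> j \<le> J\<close>, where \<open>J = dim_vec \<pi> + 1\<close>.\<close>

definition cat_prob :: "real vec \<Rightarrow> nat \<Rightarrow> real" where
  "cat_prob \<pi> j = (if j \<le> dim_vec \<pi> then \<pi> $ (j - 1) else 1 - (\<Sum>i < dim_vec \<pi>. \<pi> $ i))"

definition permute_probs :: "(nat \<Rightarrow> nat) \<Rightarrow> real vec \<Rightarrow> real vec" where
  "permute_probs \<sigma> \<pi> = vec (dim_vec \<pi>) (\<lambda>i. cat_prob \<pi> (\<sigma> (i + 1)))"

definition sequential :: "real vec \<Rightarrow> real vec" where
  "sequential \<pi> = vec (dim_vec \<pi>)
     (\<lambda>i. cat_prob \<pi> (i + 1) / (\<Sum>k = i + 1..dim_vec \<pi> + 1. cat_prob \<pi> k))"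

definition open_support :: "(real \<Rightarrow> real) \<Rightarrow> real set" where
  "open_support F = {w. 0 < F w \<and> F w < 1}"

definition symmetric_cdfs :: "(real \<Rightarrow> real) set" where
  "symmetric_cdfs = {F. (\<exists>M. real_distribution M \<and> F = cdf M) \<and> continuous_on UNIV F \<and>
     strict_mono_on (open_support F) F \<and> (\<forall>w. F w = 1 - F (- w))}"

definition complete_design :: "nat \<Rightarrow> nat \<Rightarrow> real vec \<Rightarrow> real mat" where
  "complete_design J p x = mat (J - 1) ((J - 1) * (1 + p))
     (\<lambda>(i, k). if k < J - 1 then (if k = i then 1 else 0)
              else if (k - (J - 1)) div p = i then x $ ((k - (J - 1)) mod p) else 0)"

definition design_matrices :: "nat \<Rightarrow> nat \<Rightarrow> (real vec \<Rightarrow> real mat) set" where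
  "design_matrices J p = {\<lambda>x. complete_design J p x * C | C q.
     J - 1 + p \<le> q \<and> q \<le> (J - 1) * (1 + p) \<and>
     C \<in> carrier_mat ((J - 1) * (1 + p)) q \<and> vec_space.rank ((J - 1) * (1 + p)) C = q}"

text \<open>For \<open>Z\<close> in \<^term>\<open>design_matrices J p\<close>, and for its products with constant matrices,
  \<open>dim_col (Z x)\<close> is the number \<open>q\<close> of columns, independently of \<open>x\<close>; since the set \<open>X\<close> of
  explanatory vectors is nonempty, the parameter space below is a subset of \<open>\<real>\<^sup>q\<close>.\<close>

definition param_space ::
  "nat \<Rightarrow> real vec set \<Rightarrow> (real vec \<Rightarrow> real vec) \<Rightarrow> (real \<Rightarrow> real) \<Rightarrow> (real vec \<Rightarrow> real mat) \<Rightarrow> real vec set"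
  where
  "param_space J X r F Z = {\<beta>. \<forall>x \<in> X. \<beta> \<in> carrier_vec (dim_col (Z x)) \<and>
     (\<forall>i < J - 1. (Z x *\<^sub>v \<beta>) $ i \<in> open_support F) \<and>
     map_vec F (Z x *\<^sub>v \<beta>) \<in> r ` prob_vecs J}"

text \<open>A model consists of its parameter space and the map sending \<open>x\<close> and \<open>\<beta>\<close> to \<open>\<pi>(x; \<beta>)\<close>; the
  latter is meaningful only for \<open>x\<close> in \<open>X\<close> and \<open>\<beta>\<close> in the parameter space.\<close>

type_synonym categorical_model = "real vec set \<times> (real vec \<Rightarrow> real vec \<Rightarrow> real vec)"

definition model ::
  "nat \<Rightarrow> real vec set \<Rightarrow> (real vec \<Rightarrow> real vec) \<Rightarrow> (real \<Rightarrow> real) \<Rightarrow> (real vec \<Rightarrow> real mat) \<Rightarrow> categorical_model"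
  where
  "model J X r F Z = (param_space J X r F Z,
     \<lambda>x \<beta>. THE \<pi>. \<pi> \<in> prob_vecs J \<and> r \<pi> = map_vec F (Z x *\<^sub>v \<beta>))"

definition permuted_model ::
  "nat \<Rightarrow> real vec set \<Rightarrow> (nat \<Rightarrow> nat) \<Rightarrow> (real vec \<Rightarrow> real vec) \<Rightarrow> (real \<Rightarrow> real) \<Rightarrow>
   (real vec \<Rightarrow> real mat) \<Rightarrow> categorical_model"
  where
  "permuted_model J X \<sigma> r F Z = (param_space J X r F Z,
     \<lambda>x \<beta>. THE \<pi>. \<pi> \<in> prob_vecs J \<and> r (permute_probs \<sigma> \<pi>) = map_vec F (Z x *\<^sub>v \<beta>))"

definition models_equal :: "real vec set \<Rightarrow> categorical_model \<Rightarrow> categorical_model \<Rightarrow> bool" where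
  "models_equal X m m' \<longleftrightarrow> fst m = fst m' \<and> (\<forall>x \<in> X. \<forall>\<beta> \<in> fst m. snd m x \<beta> = snd m' x \<beta>)"

definition last_transposition :: "nat \<Rightarrow> nat \<Rightarrow> nat" where
  "last_transposition J = Transposition.transpose (J - 1) J"

definition last_sign_matrix :: "nat \<Rightarrow> real mat" where
  "last_sign_matrix J = mat_diag (J - 1) (\<lambda>i. if i = J - 2 then - 1 else 1)"

text \<open>The entries of \<^const>\<open>complete_design\<close> realise
  \<open>Z\<^sub>c(x) \<beta> = (\<alpha>\<^sub>j + x\<^sup>t \<delta>\<^sub>j)\<^sub>j\<close> for the parameter \<open>\<beta>\<close> obtained by stacking \<open>\<alpha>\<close> and the \<open>\<delta>\<^sub>j\<close>.\<close>

lemma complete_design_mult: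
  assumes p: "p \<ge> 1" and x: "x \<in> carrier_vec p" and \<alpha>: "\<alpha> \<in> carrier_vec (J - 1)"
    and \<delta>: "\<And>j. j < J - 1 \<Longrightarrow> \<delta> j \<in> carrier_vec p"
  shows "complete_design J p x *\<^sub>v
      vec ((J - 1) * (1 + p)) (\<lambda>k. if k < J - 1 then \<alpha> $ k
        else \<delta> ((k - (J - 1)) div p) $ ((k - (J - 1)) mod p))
    = vec (J - 1) (\<lambda>j. \<alpha> $ j + x \<bullet> \<delta> j)"
proof (rule eq_vecI)
  fix j assume "j < dim_vec (vec (J - 1) (\<lambda>j. \<alpha> $ j + x \<bullet> \<delta> j))"
  then have j: "j < J - 1" by simp
  define n where "n = J - 1"
  define g where "g k = (if k < n then (if k = j then 1 else 0)
              else if (k - n) div p = j then x $ ((k - n) mod p) else 0) *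
            (if k < n then \<alpha> $ k else \<delta> ((k - n) div p) $ ((k - n) mod p))" for k
  have "(complete_design J p x *\<^sub>v
      vec ((J - 1) * (1 + p)) (\<lambda>k. if k < J - 1 then \<alpha> $ k
        else \<delta> ((k - (J - 1)) div p) $ ((k - (J - 1)) mod p))) $ j = (\<Sum>k = 0..<(J - 1) * (1 + p). g k)"
    unfolding g_def n_def using j
    by (simp add: complete_design_def scalar_prod_def del: One_nat_def)
  also have "\<dots> = (\<Sum>k = 0..<n + n * p. g k)" by (simp add: n_def)
  also have "\<dots> = (\<Sum>k = 0..<n. g k) + (\<Sum>k = n..<n + n * p. g k)"
    by (rule sum.atLeastLessThan_concat[symmetric]) auto
  also have "(\<Sum>k = 0..<n. g k) = (\<Sum>k = 0..<n. if k = j then \<alpha> $ k else 0)"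
    by (rule sum.cong) (auto simp: g_def)
  also have "\<dots> = \<alpha> $ j" using j by (simp add: n_def)
  also have "(\<Sum>k = n..<n + n * p. g k) = (\<Sum>k = 0..<n * p. g (k + n))"
    using sum.shift_bounds_nat_ivl[of g 0 n "n * p"] by (simp add: add.commute)
  also have "\<dots> = (\<Sum>k = j * p..<j * p + p. g (k + n))"
  proof (rule sum.mono_neutral_right)
    have "j * p + p \<le> n * p"
      using mult_le_mono1[of "Suc j" n p] j by (simp add: n_def)
    then show "{j * p..<j * p + p} \<subseteq> {0..<n * p}" by auto
    show "\<forall>k \<in> {0..<n * p} - {j * p..<j * p + p}. g (k + n) = 0"
    proof
      fix k assume k: "k \<in> {0..<n * p} - {j * p..<j * p + p}"
      have "k div p \<noteq> j"
      proof
        assume "k div p = j"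
        then have "k = j * p + k mod p" using div_mult_mod_eq[of k p] by simp
        moreover have "k mod p < p" using p by simp
        ultimately have "j * p \<le> k" "k < j * p + p" by linarith+
        then show False using k by auto
      qed
      then show "g (k + n) = 0" by (simp add: g_def)
    qed
  qed simp
  also have "\<dots> = (\<Sum>i = 0..<p. g (i + j * p + n))"
    using sum.shift_bounds_nat_ivl[of "\<lambda>k. g (k + n)" 0 "j * p" p] by (simp add: add.commute)
  also have "\<dots> = (\<Sum>i = 0..<p. x $ i * \<delta> j $ i)"
    by (rule sum.cong) (auto simp: g_def)
  also have "\<dots> = x \<bullet> \<delta> j" using \<delta>[OF j] by (simp add: scalar_prod_def)
  finally show "(complete_design J p x *\<^sub>v
      vec ((J - 1) * (1 + p)) (\<lambda>k. if k < J - 1 then \<alpha> $ k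
        else \<delta> ((k - (J - 1)) div p) $ ((k - (J - 1)) mod p))) $ j
      = vec (J - 1) (\<lambda>j. \<alpha> $ j + x \<bullet> \<delta> j) $ j"
    using j by simp
qed (simp add: complete_design_def)

text \<open>The sequential ratio is a bijection onto \<open>]0,1[\<^sup>J\<^sup>-\<^sup>1\<close>, so the definite description in
  \<^const>\<open>model\<close> denotes a unique vector.\<close>

lemma cat_prob_tail_sum:
  assumes "i \<le> dim_vec \<pi>"
  shows "(\<Sum>k = i + 1..dim_vec \<pi> + 1. cat_prob \<pi> k) = 1 - (\<Sum>k < i. \<pi> $ k)"
  using assms
proof (induction rule: inc_induct)
  case base
  show ?case by (simp add: cat_prob_def)
next
  case (step i)
  have "(\<Sum>k = i + 1..dim_vec \<pi> + 1. cat_prob \<pi> k)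
      = cat_prob \<pi> (i + 1) + (\<Sum>k = Suc i + 1..dim_vec \<pi> + 1. cat_prob \<pi> k)"
    using step.hyps by (subst sum.atLeast_Suc_atMost) (simp_all only: Suc_eq_plus1 add_le_cancel_right less_imp_le)
  also have "\<dots> = 1 - (\<Sum>k < i. \<pi> $ k)"
  proof -
    have "cat_prob \<pi> (i + 1) = \<pi> $ i" using step.hyps by (simp add: cat_prob_def)
    moreover have "(\<Sum>k < Suc i. \<pi> $ k) = (\<Sum>k < i. \<pi> $ k) + \<pi> $ i" by simp
    ultimately show ?thesis unfolding step.IH by linarith
  qed
  finally show ?case .
qed

lemma dim_sequential: "dim_vec (sequential \<pi>) = dim_vec \<pi>"
  unfolding sequential_def by (rule dim_vec)

lemma sequential_index:
  assumes "i < dim_vec \<pi>"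
  shows "sequential \<pi> $ i = \<pi> $ i / (1 - (\<Sum>k < i. \<pi> $ k))"
  unfolding sequential_def using assms cat_prob_tail_sum[of i \<pi>] by (simp add: cat_prob_def)

lemma prob_vecs_partial_sum:
  assumes "\<pi> \<in> prob_vecs J" "i \<le> J - 1"
  shows "(\<Sum>k < i. \<pi> $ k) < 1"
proof -
  have "(\<Sum>k < i. \<pi> $ k) \<le> (\<Sum>k < J - 1. \<pi> $ k)"
    using assms by (intro sum_mono2) (auto simp: prob_vecs_def intro: less_imp_le)
  also have "\<dots> < 1" using assms by (simp add: prob_vecs_def)
  finally show ?thesis .
qed

lemma sequential_bij_betw:
  "bij_betw sequential (prob_vecs J) {v \<in> carrier_vec (J - 1). \<forall>i < J - 1. 0 < v $ i \<and> v $ i < 1}"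
proof (rule bij_betwI')
  fix \<pi> \<pi>' assume *: "\<pi> \<in> prob_vecs J" "\<pi>' \<in> prob_vecs J"
  have d: "dim_vec \<pi> = J - 1" "dim_vec \<pi>' = J - 1" using * by (auto simp: prob_vecs_def)
  show "(sequential \<pi> = sequential \<pi>') = (\<pi> = \<pi>')"
  proof
    assume e: "sequential \<pi> = sequential \<pi>'"
    have "\<pi> $ i = \<pi>' $ i" if "i < J - 1" for i
      using that
    proof (induction i rule: less_induct)
      case (less i)
      have s: "(\<Sum>k < i. \<pi> $ k) = (\<Sum>k < i. \<pi>' $ k)"
        using less by (intro sum.cong) auto
      have "sequential \<pi> $ i = \<pi> $ i / (1 - (\<Sum>k < i. \<pi>' $ k))"
        using sequential_index[of i \<pi>] less.prems unfolding d s by blast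
      moreover have "sequential \<pi>' $ i = \<pi>' $ i / (1 - (\<Sum>k < i. \<pi>' $ k))"
        using sequential_index[of i \<pi>'] less.prems unfolding d by blast
      moreover have "1 - (\<Sum>k < i. \<pi>' $ k) \<noteq> 0"
        using prob_vecs_partial_sum[OF *(2), of i] less.prems by simp
      ultimately show ?case unfolding e by simp
    qed
    then show "\<pi> = \<pi>'" using d by (intro eq_vecI) auto
  qed simp
next
  fix \<pi> assume \<pi>: "\<pi> \<in> prob_vecs J"
  have d: "dim_vec \<pi> = J - 1" using \<pi> by (auto simp: prob_vecs_def)
  have "0 < sequential \<pi> $ i \<and> sequential \<pi> $ i < 1" if i: "i < J - 1" for i
    using sequential_index[of i \<pi>] i d prob_vecs_partial_sum[OF \<pi>, of i]
      prob_vecs_partial_sum[OF \<pi>, of "Suc i"] \<pi> by (simp add: prob_vecs_def)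
  moreover have "sequential \<pi> \<in> carrier_vec (J - 1)"
    by (rule carrier_vecI) (simp only: dim_sequential d)
  ultimately show "sequential \<pi> \<in> {v \<in> carrier_vec (J - 1). \<forall>i < J - 1. 0 < v $ i \<and> v $ i < 1}"
    by simp
next
  fix v :: "real vec"
  assume v: "v \<in> {v \<in> carrier_vec (J - 1). \<forall>i < J - 1. 0 < v $ i \<and> v $ i < 1}"
  define \<pi> where "\<pi> = vec (J - 1) (\<lambda>i. v $ i * (\<Prod>k < i. 1 - v $ k))"
  have s: "(\<Sum>k < i. \<pi> $ k) = 1 - (\<Prod>k < i. 1 - v $ k)" if "i \<le> J - 1" for i
    using that by (induction i) (simp_all add: \<pi>_def algebra_simps)
  have pos: "(\<Prod>k < i. 1 - v $ k) > 0" if "i \<le> J - 1" for i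
    using that v by (intro prod_pos) auto
  have le: "(\<Prod>k < i. 1 - v $ k) \<le> 1" if "i \<le> J - 1" for i
    using that v by (intro prod_le_1) (auto intro: less_imp_le)
  have "0 < \<pi> $ i \<and> \<pi> $ i < 1" if i: "i < J - 1" for i
  proof
    have vi: "0 < v $ i" "v $ i < 1" using v i by auto
    show "0 < \<pi> $ i" using i pos[of i] vi by (simp add: \<pi>_def)
    have "v $ i * (\<Prod>k < i. 1 - v $ k) \<le> v $ i"
      using le[of i] vi i by (intro mult_left_le) auto
    then have "v $ i * (\<Prod>k < i. 1 - v $ k) < 1" using vi by linarith
    then show "\<pi> $ i < 1" using i by (simp add: \<pi>_def)
  qed
  then have "\<pi> \<in> prob_vecs J"
    using s[of "J - 1"] pos[of "J - 1"] by (simp add: prob_vecs_def) (simp add: \<pi>_def)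
  moreover have "v = sequential \<pi>"
  proof (rule eq_vecI)
    show d: "dim_vec v = dim_vec (sequential \<pi>)" using v by (simp add: dim_sequential \<pi>_def)
    fix i assume "i < dim_vec (sequential \<pi>)"
    then have i: "i < J - 1" by (simp add: dim_sequential \<pi>_def)
    then have "sequential \<pi> $ i = \<pi> $ i / (\<Prod>k < i. 1 - v $ k)"
      using sequential_index[of i \<pi>] s[of i] by (simp add: \<pi>_def)
    moreover have "\<pi> $ i = v $ i * (\<Prod>k < i. 1 - v $ k)" using i by (simp add: \<pi>_def)
    moreover have "(\<Prod>k < i. 1 - v $ k) \<noteq> 0" using pos[of i] i by linarith
    ultimately show "v $ i = sequential \<pi> $ i"
      by (simp only: nonzero_mult_div_cancel_right not_False_eq_True)
  qed
  ultimately show "\<exists>\<pi> \<in> prob_vecs J. v = sequential \<pi>" by blast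
qed

end

theory Submission
  imports Defs
begin

text \<open>Exchanging the last two categories leaves all but the last component of the sequential
  ratio unchanged, and turns the last one, \<open>\<pi>\<^bsub>J-1\<^esub> / (\<pi>\<^bsub>J-1\<^esub> + \<pi>\<^sub>J)\<close>, into its complement
  \<open>\<pi>\<^sub>J / (\<pi>\<^bsub>J-1\<^esub> + \<pi>\<^sub>J)\<close>. By symmetry of \<open>F\<close>, taking the complement of \<open>F(\<eta>)\<close> is changing the
  sign of \<open>\<eta>\<close>. Since the sequential ratio maps onto the whole cube, the parameter space only
  requires the predictors to lie in the open support of \<open>F\<close>, which is symmetric about \<open>0\<close>.\<close>

lemma mat_diag_mult_mat_vec_index:
  fixes M :: "'a :: comm_semiring_1 mat"
  assumes "M \<in> carrier_mat n m" and "b \<in> carrier_vec m" and "i < n"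
  shows "((mat_diag n f * M) *\<^sub>v b) $ i = f i * (M *\<^sub>v b) $ i"
  using assms
  by (simp add: mat_diag_mult_left scalar_prod_def sum_distrib_left mult.assoc)

lemma last_sign_matrix_mult_index:
  assumes "M \<in> carrier_mat (J - 1) m" and "b \<in> carrier_vec m" and "i < J - 1"
  shows "((last_sign_matrix J * M) *\<^sub>v b) $ i =
    (if i = J - 2 then - (M *\<^sub>v b) $ i else (M *\<^sub>v b) $ i)"
  unfolding last_sign_matrix_def mat_diag_mult_mat_vec_index[OF assms] by simp

lemma symmetric_cdfs_minus:
  assumes "F \<in> symmetric_cdfs"
  shows "F (- w) = 1 - F w"
  using assms unfolding symmetric_cdfs_def by (metis (mono_tags, lifting) mem_Collect_eq minus_minus)

text \<open>Entries are indexed from 0, so category \<open>J - 1\<close> sits at index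
  \<open>J - 2\<close>. Category \<open>J\<close> is not stored in the vector, so its probability
  enters as the complement of the full sum.\<close>

lemma permute_probs_last_transposition_index:
  assumes "J \<ge> 3" and "\<pi> \<in> carrier_vec (J - 1)" and "i < J - 1"
  shows "permute_probs (last_transposition J) \<pi> $ i =
    (if i = J - 2 then 1 - (\<Sum>k < J - 1. \<pi> $ k) else \<pi> $ i)"
  using assms
  by (auto simp: permute_probs_def cat_prob_def last_transposition_def Transposition.transpose_def)

lemma sequential_last_transposition:
  assumes J: "J \<ge> 3" and \<pi>: "\<pi> \<in> prob_vecs J" and i: "i < J - 1"
  shows "sequential (permute_probs (last_transposition J) \<pi>) $ i =
    (if i = J - 2 then 1 - sequential \<pi> $ i else sequential \<pi> $ i)"
proof -
  let ?\<rho> = "permute_probs (last_transposition J) \<pi>"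
  have c: "\<pi> \<in> carrier_vec (J - 1)" using \<pi> by (simp add: prob_vecs_def)
  then have d: "dim_vec \<pi> = J - 1" "dim_vec ?\<rho> = J - 1" by (auto simp: permute_probs_def)
  note \<rho> = permute_probs_last_transposition_index[OF J c]
  \<comment> \<open>Every \<open>k < i\<close> is below \<open>J - 2\<close>, the only index the
    exchange alters, so both ratios have the same denominator.\<close>
  have s: "(\<Sum>k < i. ?\<rho> $ k) = (\<Sum>k < i. \<pi> $ k)"
    using i by (intro sum.cong) (auto simp: \<rho>)
  have seq: "sequential ?\<rho> $ i = ?\<rho> $ i / (1 - (\<Sum>k < i. \<pi> $ k))"
    "sequential \<pi> $ i = \<pi> $ i / (1 - (\<Sum>k < i. \<pi> $ k))"
    using sequential_index[of i ?\<rho>] sequential_index[of i \<pi>] i by (simp_all add: d s)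
  show ?thesis
  proof (cases "i = J - 2")
    case True
    \<comment> \<open>Splitting the last term off the full sum writes the new numerator as the
      common denominator minus the old numerator; division then gives the complement.\<close>
    then have "J - 1 = Suc i" using J by simp
    then have "?\<rho> $ i = (1 - (\<Sum>k < i. \<pi> $ k)) - \<pi> $ i" using \<rho>[OF i] True by simp
    moreover have "1 - (\<Sum>k < i. \<pi> $ k) \<noteq> 0"
      using prob_vecs_partial_sum[OF \<pi>, of i] i by simp
    ultimately show ?thesis using True seq by (simp add: diff_divide_distrib)
  next
    case False
    then show ?thesis using seq \<rho>[OF i] by simp
  qed
qed

text \<open>Predictors in the open support have \<open>F\<close>-values in the open unit cube, which
  is the whole image of \<open>sequential\<close>. The dimension assumption places the predictor in
  the right space.\<close>

lemma param_space_sequential: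
  assumes "\<And>x. x \<in> X \<Longrightarrow> dim_row (Z x) = J - 1"
  shows "param_space J X sequential F Z = {\<beta>. \<forall>x \<in> X. \<beta> \<in> carrier_vec (dim_col (Z x)) \<and>
    (\<forall>i < J - 1. (Z x *\<^sub>v \<beta>) $ i \<in> open_support F)}"
  using bij_betw_imp_surj_on[OF sequential_bij_betw[of J]] assms
  by (auto simp: param_space_def open_support_def intro!: carrier_vecI)

theorem mainTheorem14:
  fixes J p :: nat and X :: "real vec set"
    and F :: "real \<Rightarrow> real" and Z :: "real vec \<Rightarrow> real mat"
  assumes "J \<ge> 3" and "p \<ge> 1"
    and "X \<subseteq> carrier_vec p" and "X \<noteq> {}"
    and "F \<in> symmetric_cdfs" and "Z \<in> design_matrices J p"
  shows "models_equal X
    (permuted_model J X (last_transposition J) sequential F Z)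
    (model J X sequential F (\<lambda>x. last_sign_matrix J * Z x))"
proof -
  let ?AZ = "\<lambda>x. last_sign_matrix J * Z x"
  have Z: "dim_row (Z x) = J - 1" for x
    using assms(6) by (auto simp: design_matrices_def complete_design_def)
  have AZ: "dim_row (?AZ x) = J - 1" for x by (simp add: last_sign_matrix_def mat_diag_def)
  have \<eta>: "(?AZ x *\<^sub>v \<beta>) $ i = (if i = J - 2 then - (Z x *\<^sub>v \<beta>) $ i else (Z x *\<^sub>v \<beta>) $ i)"
    if "\<beta> \<in> carrier_vec (dim_col (Z x))" "i < J - 1" for x \<beta> i
    using last_sign_matrix_mult_index[OF _ that] Z by blast
  note F = symmetric_cdfs_minus[OF assms(5)]
  have "(?AZ x *\<^sub>v \<beta>) $ i \<in> open_support F \<longleftrightarrow> (Z x *\<^sub>v \<beta>) $ i \<in> open_support F"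
    if "\<beta> \<in> carrier_vec (dim_col (Z x))" "i < J - 1" for x \<beta> i
    unfolding \<eta>[OF that] by (auto simp: open_support_def F)
  then have space: "param_space J X sequential F Z = param_space J X sequential F ?AZ"
    unfolding param_space_sequential[of X Z J, OF Z] param_space_sequential[of X ?AZ J, OF AZ]
    by auto
  \<comment> \<open>Both models define \<pi> by a definite description, so it suffices that the two
    predicates agree for each candidate \<pi>.\<close>
  have "sequential (permute_probs (last_transposition J) \<pi>) = map_vec F (Z x *\<^sub>v \<beta>) \<longleftrightarrow>
      sequential \<pi> = map_vec F (?AZ x *\<^sub>v \<beta>)"
    if \<beta>: "\<beta> \<in> carrier_vec (dim_col (Z x))" and \<pi>: "\<pi> \<in> prob_vecs J" for x \<beta> \<pi>
  proof -
    let ?\<rho> = "permute_probs (last_transposition J) \<pi>"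
    have d: "dim_vec (sequential \<pi>) = J - 1" "dim_vec (sequential ?\<rho>) = J - 1"
      using \<pi> by (auto simp: dim_sequential permute_probs_def prob_vecs_def)
    \<comment> \<open>At the last index, with s the ratio of \<pi> and \<eta> the original
      predictor, this compares 1 - s = F(\<eta>) with s = F(-\<eta>).\<close>
    have "sequential ?\<rho> $ i = F ((Z x *\<^sub>v \<beta>) $ i) \<longleftrightarrow> sequential \<pi> $ i = F ((?AZ x *\<^sub>v \<beta>) $ i)"
      if i: "i < J - 1" for i
      unfolding sequential_last_transposition[OF assms(1) \<pi> i] \<eta>[OF \<beta> i] by (auto simp: F)
    then show ?thesis
      by (simp add: vec_eq_iff d Z AZ del: index_mult_mat_vec index_mult_mat(2))
  qed
  then have "(THE \<pi>. \<pi> \<in> prob_vecs J \<and>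
        sequential (permute_probs (last_transposition J) \<pi>) = map_vec F (Z x *\<^sub>v \<beta>)) =
      (THE \<pi>. \<pi> \<in> prob_vecs J \<and> sequential \<pi> = map_vec F (?AZ x *\<^sub>v \<beta>))"
    if "x \<in> X" "\<beta> \<in> param_space J X sequential F Z" for x \<beta>
    using that by (intro arg_cong[where f = The] ext) (auto simp: param_space_def)
  with space show ?thesis
    by (simp add: models_equal_def permuted_model_def model_def)
qed

end
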